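(* Let $E(x)=\sum_{n>0} e(n)\frac{x^n}{n!}$ be an exponential generating function, where $(e(n))_{n\ge 1}$ is a sequence of integers, and let $E^{\Delta}(n,k)$ be the composita of $E(x)$. Then for every prime $n$ the number $$\sum_{k=2}^{n-1} E^{\Delta}(n,k)\,\frac{(n-1)!}{k!}$$ is an integer.
   Context: An exponential generating function (with zero constant term) is a formal power series $\sum_{n\ge 1} \frac{e(n)}{n!}x^n$, where $e(n)$ is a sequence of integers. For a formal power series $F(x)=\sum_{n>0} f(n)x^n$ with zero constant term, the composita $F^{\Delta}(n,k)$ (for positive integers $n,k$) is the coefficient of $x^n$ in $[F(x)]^k$, i.e. $[F(x)]^k=\sum_{n>0}F^{\Delta}(n,k)x^n$. Equivalently, $$F^{\Delta}(n,k)=\sum_{\lambda_1+\cdots+\lambda_k=n,\ \lambda_i\ge 1} f(\lambda_1)f(\lambda_2)\cdots f(\lambda_k),$$ the sum being over all compositions (ordered tuples of positive integers) of $n$ into exactly $k$ parts. For the series $E(x)$ the ordinary coefficients are $f(n)=e(n)/n!$. An empty sum is $0$. *)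

theory Defs
  imports "HOL-Computational_Algebra.Computational_Algebra"
begin

(* The value e 0 is irrelevant: the series has zero constant term. *)
definition egf :: "(nat \<Rightarrow> int) \<Rightarrow> rat fps" where
  "egf e = Abs_fps (\<lambda>n. if n = 0 then 0 else of_int (e n) / fact n)"

(* Intended for series F with zero constant term and for positive n and k. *)
definition composita :: "'a::comm_ring_1 fps \<Rightarrow> nat \<Rightarrow> nat \<Rightarrow> 'a" where
  "composita F n k = fps_nth (F ^ k) n"

end

theory Submission
  imports Defs
begin

text \<open>
  Write \<open>B(n, k) = n! [x\<^sup>n] E(x)\<^sup>k / k!\<close>, the partial Bell polynomial evaluated at the sequence \<open>e\<close>.
  Each summand with index \<open>k\<close> equals \<open>B(n, k) / n\<close>, and every one of them is already an integer when
  \<open>n\<close> is prime and \<open>2 \<le> k < n\<close>. Two recurrences for \<open>B\<close> show this.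

  Differentiating \<open>E\<^sup>k\<^sup>+\<^sup>1 / (k + 1)!\<close> gives \<open>(E\<^sup>k / k!) E'\<close>. In this identity no
  division is left over, so \<open>B(n, k)\<close> is an integer by induction on \<open>k\<close>
  (\<open>egf_power_fact_Ints\<close>). Combinatorially, the recurrence classifies set partitions by
  the block that contains one fixed element.

  Multiplying \<open>E\<^sup>k\<close> by \<open>E\<close> marks an arbitrary one of the \<open>k + 1\<close> blocks instead, and gives
  \<open>(k + 1) B(n, k + 1) = \<Sum> (n choose i) B(i, k) e(n - i)\<close>. For \<open>k \<ge> 1\<close> the two extreme terms
  vanish, and a prime \<open>n\<close> divides all other binomial coefficients; it therefore divides
  \<open>(k + 1) B(n, k + 1)\<close>, and as \<open>k + 1 < n\<close> is coprime to \<open>n\<close>, it divides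
  \<open>B(n, k + 1)\<close> (\<open>prime_dvd_egf_power_fact\<close>).
\<close>

lemma egf_nth_0 [simp]: "fps_nth (egf e) 0 = 0"
  by (simp add: egf_def)

lemma egf_nth_Suc: "fps_nth (egf e) (Suc m) = of_int (e (Suc m)) / fact (Suc m)"
  by (simp add: egf_def)

text \<open>
  The coefficientwise form of \<open>(E\<^sup>k\<^sup>+\<^sup>1 / (k + 1)!)' = (E\<^sup>k / k!) E'\<close>; the factor \<open>n + 1\<close> that
  differentiation produces is absorbed by \<open>(n + 1)!\<close>.
\<close>

lemma egf_power_Suc_fact_recurrence:
  "fact (Suc n) * fps_nth (egf e ^ Suc k) (Suc n) / fact (Suc k) =
     (\<Sum>i=0..n. of_nat (n choose i) * (fact i * fps_nth (egf e ^ k) i / fact k)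
                  * of_int (e (Suc (n - i))))"
proof -
  have "of_nat (Suc n) * fps_nth (egf e ^ Suc k) (Suc n) = fps_nth (fps_deriv (egf e ^ Suc k)) n"
    by (simp only: fps_deriv_nth Suc_eq_plus1)
  also have "fps_deriv (egf e ^ Suc k) = of_nat (Suc k) * (egf e ^ k * fps_deriv (egf e))"
    by (simp only: fps_deriv_power fps_of_nat diff_Suc_1 mult_ac)
  also have "fps_nth \<dots> n =
      of_nat (Suc k) * (\<Sum>i=0..n. fps_nth (egf e ^ k) i * fps_nth (fps_deriv (egf e)) (n - i))"
    by (subst fps_mult_of_nat_nth, subst fps_mult_nth) (rule refl)
  finally have deriv: "of_nat (Suc n) * fps_nth (egf e ^ Suc k) (Suc n) =
      of_nat (Suc k) * (\<Sum>i=0..n. fps_nth (egf e ^ k) i * fps_nth (fps_deriv (egf e)) (n - i))" .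
  have "fact (Suc n) * fps_nth (egf e ^ Suc k) (Suc n) / fact (Suc k)
      = fact n * (of_nat (Suc n) * fps_nth (egf e ^ Suc k) (Suc n)) / fact (Suc k)"
    by (simp only: fact_Suc of_nat_mult mult_ac)
  also have "\<dots> = fact n / fact k *
      (\<Sum>i=0..n. fps_nth (egf e ^ k) i * fps_nth (fps_deriv (egf e)) (n - i))"
    unfolding deriv by (simp del: of_nat_Suc)
  also have "\<dots> = (\<Sum>i=0..n. of_nat (n choose i) * (fact i * fps_nth (egf e ^ k) i / fact k)
                  * of_int (e (Suc (n - i))))"
    unfolding sum_distrib_left
  proof (rule sum.cong)
    fix i assume "i \<in> {0..n}"
    then have "of_nat (n choose i) = (fact n / (fact i * fact (n - i)) :: rat)"
      by (simp add: binomial_fact)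
    moreover have "fps_nth (fps_deriv (egf e)) (n - i) = of_int (e (Suc (n - i))) / fact (n - i)"
      by (simp add: egf_nth_Suc del: of_nat_Suc)
    ultimately show "fact n / fact k *
        (fps_nth (egf e ^ k) i * fps_nth (fps_deriv (egf e)) (n - i)) =
        of_nat (n choose i) * (fact i * fps_nth (egf e ^ k) i / fact k) * of_int (e (Suc (n - i)))"
      by (simp add: mult_ac del: fps_deriv_nth)
  qed simp
  finally show ?thesis .
qed

lemma egf_power_fact_Ints: "fact n * fps_nth (egf e ^ k) n / fact k \<in> \<int>"
proof (induction k arbitrary: n)
  case 0
  show ?case by simp
next
  case (Suc k)
  show ?case
  proof (cases n)
    case 0
    then show ?thesis by simp
  next
    case (Suc m)
    show ?thesis
      unfolding Suc egf_power_Suc_fact_recurrence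
      by (intro Ints_sum Ints_mult Suc.IH) simp_all
  qed
qed

text \<open>
  The coefficientwise form of \<open>E\<^sup>k\<^sup>+\<^sup>1 / k! = (E\<^sup>k / k!) E\<close>. Dividing by \<open>k!\<close> rather than
  \<open>(k + 1)!\<close> keeps all quantities integral. The two boundary terms \<open>i = 0\<close> and \<open>i = n\<close> are absent:
  both \<open>E\<^sup>k\<close> and \<open>E\<close> have zero constant term.
\<close>

lemma egf_power_Suc_fact_convolution:
  assumes "k \<ge> 1"
  shows "fact n * fps_nth (egf e ^ Suc k) n / fact k =
     (\<Sum>i\<in>{0<..<n}. of_nat (n choose i) * (fact i * fps_nth (egf e ^ k) i / fact k)
                  * of_int (e (n - i)))"
proof -
  have "fact n * fps_nth (egf e ^ Suc k) n / fact k =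
      (\<Sum>i=0..n. fact n / fact k * (fps_nth (egf e ^ k) i * fps_nth (egf e) (n - i)))"
    unfolding power_Suc2 fps_mult_nth by (simp add: sum_distrib_left sum_divide_distrib)
  also have "\<dots> = (\<Sum>i\<in>{0<..<n}. fact n / fact k *
                    (fps_nth (egf e ^ k) i * fps_nth (egf e) (n - i)))"
  proof (rule sum.mono_neutral_right)
    show "\<forall>i\<in>{0..n} - {0<..<n}. fact n / fact k *
            (fps_nth (egf e ^ k) i * fps_nth (egf e) (n - i)) = 0"
    proof
      fix i assume "i \<in> {0..n} - {0<..<n}"
      then have "i = 0 \<or> i = n" by auto
      then show "fact n / fact k * (fps_nth (egf e ^ k) i * fps_nth (egf e) (n - i)) = 0"
        using assms by auto
    qed
  qed auto
  also have "\<dots> = (\<Sum>i\<in>{0<..<n}. of_nat (n choose i) * (fact i * fps_nth (egf e ^ k) i / fact k)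
                    * of_int (e (n - i)))"
  proof (rule sum.cong)
    fix i assume i: "i \<in> {0<..<n}"
    then have "of_nat (n choose i) = (fact n / (fact i * fact (n - i)) :: rat)"
      by (simp add: binomial_fact)
    moreover have "fps_nth (egf e) (n - i) = of_int (e (n - i)) / fact (n - i)"
      using i by (simp add: egf_def)
    ultimately show "fact n / fact k * (fps_nth (egf e ^ k) i * fps_nth (egf e) (n - i)) =
        of_nat (n choose i) * (fact i * fps_nth (egf e ^ k) i / fact k) * of_int (e (n - i))"
      by (simp add: mult_ac)
  qed simp
  finally show ?thesis .
qed

text \<open>
  The hypothesis \<open>k < p\<close> is what allows the factor \<open>k\<close> to be cancelled modulo \<open>p\<close>; the hypothesis
  \<open>k \<ge> 2\<close> excludes \<open>B(p, 1) = e(p)\<close>, which is arbitrary.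
\<close>

lemma prime_dvd_egf_power_fact:
  assumes p: "prime p" and k: "2 \<le> k" "k < p"
  shows "\<exists>c::int. fact p * fps_nth (egf e ^ k) p / fact k = of_nat p * of_int c"
proof -
  obtain j where j: "k = Suc j" "j \<ge> 1"
    using k by (cases k) auto
  obtain b :: int where b: "fact p * fps_nth (egf e ^ k) p / fact k = of_int b"
    by (rule Ints_cases[OF egf_power_fact_Ints])
  have "\<forall>i. \<exists>z::int. fact i * fps_nth (egf e ^ j) i / fact j = of_int z"
    by (intro allI) (rule Ints_cases[OF egf_power_fact_Ints], blast)
  then obtain a :: "nat \<Rightarrow> int"
    where a: "\<And>i. fact i * fps_nth (egf e ^ j) i / fact j = of_int (a i)"
    unfolding choice_iff by blast
  have "of_int (int k * b) = of_nat k * (fact p * fps_nth (egf e ^ k) p / fact k)"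
    by (simp add: b)
  also have "\<dots> = fact p * fps_nth (egf e ^ Suc j) p / fact j"
    unfolding j(1) by (simp del: of_nat_Suc power_Suc)
  also have "\<dots> = of_int (\<Sum>i\<in>{0<..<p}. int (p choose i) * a i * e (p - i))"
    unfolding egf_power_Suc_fact_convolution[OF j(2)] by (simp add: a)
  finally have "int k * b = (\<Sum>i\<in>{0<..<p}. int (p choose i) * a i * e (p - i))"
    by (simp only: of_int_eq_iff)
  moreover have "int p dvd (\<Sum>i\<in>{0<..<p}. int (p choose i) * a i * e (p - i))"
    using p by (intro dvd_sum dvd_mult2) (auto intro!: dvd_choose_prime)
  ultimately have "int p dvd int k * b"
    by simp
  moreover have "\<not> int p dvd int k"
    using k by (auto dest: dvd_imp_le)
  ultimately have "int p dvd b"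
    using p by (auto simp: prime_dvd_mult_iff)
  then show ?thesis
    using b by (auto simp: dvd_def)
qed

theorem corollary4:
  fixes e :: "nat \<Rightarrow> int" and n :: nat
  assumes "prime n"
  shows "(\<Sum>k = 2..n - 1. composita (egf e) n k * (fact (n - 1) / fact k)) \<in> \<int>"
proof (rule Ints_sum)
  fix k assume "k \<in> {2..n - 1}"
  then have k: "2 \<le> k" "k < n" by auto
  obtain c :: int where c: "fact n * fps_nth (egf e ^ k) n / fact k = of_nat n * of_int c"
    using prime_dvd_egf_power_fact[OF assms k] by blast
  have n: "n > 0" using k by simp
  have "of_nat n * (composita (egf e) n k * (fact (n - 1) / fact k)) =
      fact n * fps_nth (egf e ^ k) n / fact k"
    unfolding composita_def fact_reduce[OF n] by simp
  also have "\<dots> = of_nat n * of_int c" by (fact c)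
  finally have "composita (egf e) n k * (fact (n - 1) / fact k) = of_int c"
    using n by (subst (asm) mult_cancel_left) simp
  then show "composita (egf e) n k * (fact (n - 1) / fact k) \<in> \<int>"
    by simp
qed

end
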